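(* There exist $n$, a vector $\mathbf{x} \in [0,1]^n$, a purchase decision tree $t$ on the products $\{1,\dots,n\}$, and revenues $\rho_1, \dots, \rho_n$ for which the greedy solution to the subproblem (P') is not optimal.
   Context: Let $\mathcal{N} = \{1,\dots,n\}$ be the set of products and $0$ the no-purchase option, with revenues $\rho_i$ ($i \in \mathcal{N}$) and $\rho_0 = 0$. A purchase decision tree $t$ is a finite rooted binary tree in which every non-leaf node (called a split) has exactly one left child and one right child; $\mathrm{splits}(t)$ and $\mathrm{leaves}(t)$ are its sets of splits and leaves. Each split $s$ is labelled with a product $v(t,s) \in \mathcal{N}$ and each leaf $\ell$ with an option $c(t,\ell) \in \mathcal{N} \cup \{0\}$; $r_{t,\ell} = \rho_{c(t,\ell)}$. Standing assumption: if a split $s'$ is a descendant of a split $s$, then $v(t,s) \neq v(t,s')$. For a split $s$, $\mathrm{left}(s)$ (resp. $\mathrm{right}(s)$) is the set of leaves in the subtree rooted at the left (resp. right) child of $s$. Given an assortment $S \subseteq \mathcal{N}$, one moves from the root to a leaf by going to the left child at split $s$ if $v(t,s) \in S$ and to the right child otherwise. Let $P(t) = \{i \in \mathcal{N} : i = v(t,s) \text{ for some } s \in \mathrm{splits}(t)\}$; for $i \in P(t)$ let $\mathrm{left}(i) = \bigcup_{s:\, v(t,s)=i} \mathrm{left}(s)$ and $\mathrm{right}(i) = \bigcup_{s:\, v(t,s)=i} \mathrm{right}(s)$. Subproblem (P'), for a given $\mathbf{x} = (x_1,\dots,x_n) \in [0,1]^n$ and tree $t$: maximize $\sum_{\ell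 \in \mathrm{leaves}(t)} r_{t,\ell}\, y_{t,\ell}$ over $(y_{t,\ell})_{\ell \in \mathrm{leaves}(t)}$ subject to $\sum_{\ell \in \mathrm{leaves}(t)} y_{t,\ell} = 1$; $\ \sum_{\ell \in \mathrm{left}(i)} y_{t,\ell} \le x_i$ for all $i \in P(t)$; $\ \sum_{\ell \in \mathrm{right}(i)} y_{t,\ell} \le 1 - x_i$ for all $i \in P(t)$; $\ y_{t,\ell} \ge 0$ for all $\ell \in \mathrm{leaves}(t)$. Greedy solution: start with all $y_{t,\ell} = 0$, go through the leaves from highest to lowest revenue $r_{t,\ell}$, and set each $y_{t,\ell}$ in turn to the largest value that violates none of the constraints $\sum_{\ell' \in \mathrm{left}(i)} y_{t,\ell'} \le x_i$, $\sum_{\ell' \in \mathrm{right}(i)} y_{t,\ell'} \le 1 - x_i$ ($i \in P(t)$) and $\sum_{\ell' \in \mathrm{leaves}(t)} y_{t,\ell'} \le 1$, given the values already set. *)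

theory Defs
  imports Complex_Main "HOL-Library.Sublist"
begin

datatype pdtree = Leaf nat | Split nat pdtree pdtree

text \<open>
  A node of a tree is identified with the path of left and right turns that leads to it from
  the root; the root is the empty path, and the proper descendants of a node are its strict
  extensions.
\<close>

datatype turn = L | R

type_synonym node = "turn list"

fun splits :: "pdtree \<Rightarrow> node set" where
  "splits (Leaf c) = {}"
| "splits (Split v l r) = insert [] (Cons L ` splits l \<union> Cons R ` splits r)"

fun leaves :: "pdtree \<Rightarrow> node set" where
  "leaves (Leaf c) = {[]}"
| "leaves (Split v l r) = Cons L ` leaves l \<union> Cons R ` leaves r"

text \<open>
  The label is the product \<open>v(t,s)\<close> when the node is a split and the option \<open>c(t,\<ell>)\<close>
  when it is a leaf. It is only meaningful for nodes of the tree. Option \<open>0\<close> is no-purchase.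
\<close>

fun label :: "pdtree \<Rightarrow> node \<Rightarrow> nat" where
  "label (Leaf c) p = c"
| "label (Split v l r) [] = v"
| "label (Split v l r) (L # p) = label l p"
| "label (Split v l r) (R # p) = label r p"

definition purchase_decision_tree :: "nat \<Rightarrow> pdtree \<Rightarrow> bool" where
  "purchase_decision_tree n t \<longleftrightarrow>
     (\<forall>s\<in>splits t. label t s \<in> {1..n}) \<and>
     (\<forall>l\<in>leaves t. label t l \<in> {0..n}) \<and>
     (\<forall>s\<in>splits t. \<forall>s'\<in>splits t. strict_prefix s s' \<longrightarrow> label t s \<noteq> label t s')"

definition left_leaves :: "pdtree \<Rightarrow> node \<Rightarrow> node set" where
  "left_leaves t s = {l \<in> leaves t. prefix (s @ [L]) l}"

definition right_leaves :: "pdtree \<Rightarrow> node \<Rightarrow> node set" where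
  "right_leaves t s = {l \<in> leaves t. prefix (s @ [R]) l}"

definition tree_products :: "pdtree \<Rightarrow> nat set" where
  "tree_products t = label t ` splits t"

definition left_of_product :: "pdtree \<Rightarrow> nat \<Rightarrow> node set" where
  "left_of_product t i = (\<Union>s\<in>{s \<in> splits t. label t s = i}. left_leaves t s)"

definition right_of_product :: "pdtree \<Rightarrow> nat \<Rightarrow> node set" where
  "right_of_product t i = (\<Union>s\<in>{s \<in> splits t. label t s = i}. right_leaves t s)"

definition objective :: "(nat \<Rightarrow> real) \<Rightarrow> pdtree \<Rightarrow> (node \<Rightarrow> real) \<Rightarrow> real" where
  "objective \<rho> t y = (\<Sum>l\<in>leaves t. \<rho> (label t l) * y l)"

definition feasible :: "(nat \<Rightarrow> real) \<Rightarrow> pdtree \<Rightarrow> (node \<Rightarrow> real) \<Rightarrow> bool" where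
  "feasible x t y \<longleftrightarrow>
     (\<Sum>l\<in>leaves t. y l) = 1 \<and>
     (\<forall>i\<in>tree_products t. (\<Sum>l\<in>left_of_product t i. y l) \<le> x i) \<and>
     (\<forall>i\<in>tree_products t. (\<Sum>l\<in>right_of_product t i. y l) \<le> 1 - x i) \<and>
     (\<forall>l\<in>leaves t. 0 \<le> y l)"

definition optimal :: "(nat \<Rightarrow> real) \<Rightarrow> (nat \<Rightarrow> real) \<Rightarrow> pdtree \<Rightarrow> (node \<Rightarrow> real) \<Rightarrow> bool" where
  "optimal \<rho> x t y \<longleftrightarrow> is_arg_max (objective \<rho> t) (feasible x t) y"

definition within_capacities :: "(nat \<Rightarrow> real) \<Rightarrow> pdtree \<Rightarrow> (node \<Rightarrow> real) \<Rightarrow> bool" where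
  "within_capacities x t y \<longleftrightarrow>
     (\<forall>i\<in>tree_products t. (\<Sum>l\<in>left_of_product t i. y l) \<le> x i) \<and>
     (\<forall>i\<in>tree_products t. (\<Sum>l\<in>right_of_product t i. y l) \<le> 1 - x i) \<and>
     (\<Sum>l\<in>leaves t. y l) \<le> 1"

text \<open>
  For a leaf \<open>l\<close> the maximum below exists as soon as some value is admissible: the constraints
  are finitely many non-strict upper bounds on \<open>q\<close>, one of which comes from the total.
\<close>

definition greedy_step ::
  "(nat \<Rightarrow> real) \<Rightarrow> pdtree \<Rightarrow> (node \<Rightarrow> real) \<Rightarrow> node \<Rightarrow> (node \<Rightarrow> real)" where
  "greedy_step x t y l = y(l := (GREATEST q. within_capacities x t (y(l := q))))"

definition revenue_order :: "(nat \<Rightarrow> real) \<Rightarrow> pdtree \<Rightarrow> node list \<Rightarrow> bool" where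
  "revenue_order \<rho> t ls \<longleftrightarrow>
     distinct ls \<and> set ls = leaves t \<and>
     sorted_wrt (\<lambda>l l'. \<rho> (label t l) \<ge> \<rho> (label t l')) ls"

text \<open>Leaves of equal revenue may be visited in any order.\<close>

definition greedy_solution ::
  "(nat \<Rightarrow> real) \<Rightarrow> (nat \<Rightarrow> real) \<Rightarrow> pdtree \<Rightarrow> (node \<Rightarrow> real) \<Rightarrow> bool" where
  "greedy_solution \<rho> x t y \<longleftrightarrow>
     (\<exists>ls. revenue_order \<rho> t ls \<and> y = foldl (greedy_step x t) (\<lambda>_. 0) ls)"

lemma finite_leaves: "finite (leaves t)"
  by (induction t) auto

lemma greedy_solution_exists: "\<exists>y. greedy_solution \<rho> x t y"
proof -
  obtain ls where ls: "set ls = leaves t" "distinct ls"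
    using finite_distinct_list[OF finite_leaves] by blast
  let ?ls = "sort_key (\<lambda>l. - \<rho> (label t l)) ls"
  have "sorted (map (\<lambda>l. - \<rho> (label t l)) ?ls)"
    by (rule sorted_sort_key)
  then have "revenue_order \<rho> t ?ls"
    using ls by (simp add: revenue_order_def sorted_map)
  then show ?thesis
    unfolding greedy_solution_def by blast
qed

end

theory Submission
  imports Defs
begin

text \<open>
  The counterexample is a depth-two tree in which both subtrees split on the same product, so
  that one capacity is shared between the two sides of the root. With \<open>x\<^sub>1 = x\<^sub>2 = 1/2\<close>
  the constraints on the four leaf values are those of a transportation problem on a
  two-by-two table whose row and column sums are all \<open>1/2\<close>: rows are the two sides of
  product 1, columns those of product 2. Every feasible point thus has the form
  \<open>(a, 1/2 - a; 1/2 - a, a)\<close>.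

  The revenues are \<open>(3, 2; 2, 0)\<close>. The largest entry attracts the greedy algorithm, which
  spends all of its row and its column there. This blocks both entries of revenue 2 and
  leaves only the worthless entry for the remaining half: the value is at most \<open>3/2\<close>, whereas
  the opposite diagonal has value \<open>2\<close>. The failure is thus the classical one of greedy
  transportation without a Monge condition, here \<open>3 + 0 < 2 + 2\<close>. As the top leaf is the only
  one of revenue 3, its value alone, which the first step settles, decides the comparison, so
  the order in which the two tied leaves are visited is irrelevant.
\<close>

definition shared_product_tree :: pdtree where
  "shared_product_tree = Split 1 (Split 2 (Leaf 1) (Leaf 2)) (Split 2 (Leaf 2) (Leaf 0))"

definition bait_revenue :: "nat \<Rightarrow> real" where
  "bait_revenue i = (if i = 1 then 3 else if i = 2 then 2 else 0)"

definition half :: "nat \<Rightarrow> real" where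
  "half i = 1/2"

lemma splits_shared_product_tree: "splits shared_product_tree = {[], [L], [R]}"
  by (auto simp: shared_product_tree_def)

lemma leaves_shared_product_tree:
  "leaves shared_product_tree = {[L, L], [L, R], [R, L], [R, R]}"
  by (auto simp: shared_product_tree_def)

lemma label_shared_product_tree:
  "label shared_product_tree [] = 1"
  "label shared_product_tree [L] = 2"
  "label shared_product_tree [R] = 2"
  "label shared_product_tree [L, L] = 1"
  "label shared_product_tree [L, R] = 2"
  "label shared_product_tree [R, L] = 2"
  "label shared_product_tree [R, R] = 0"
  by (simp_all add: shared_product_tree_def)

lemma tree_products_shared_product_tree: "tree_products shared_product_tree = {1, 2}"
  by (auto simp: tree_products_def splits_shared_product_tree label_shared_product_tree)

lemma purchase_decision_tree_shared_product_tree: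
  "purchase_decision_tree 2 shared_product_tree"
  by (auto simp: purchase_decision_tree_def splits_shared_product_tree
      leaves_shared_product_tree label_shared_product_tree)

lemma splits_with_label_shared_product_tree:
  "{s \<in> splits shared_product_tree. label shared_product_tree s = 1} = {[]}"
  "{s \<in> splits shared_product_tree. label shared_product_tree s = 2} = {[L], [R]}"
  by (auto simp: splits_shared_product_tree label_shared_product_tree)

lemma left_of_product_shared_product_tree:
  "left_of_product shared_product_tree 1 = {[L, L], [L, R]}"
  "left_of_product shared_product_tree 2 = {[L, L], [R, L]}"
  unfolding left_of_product_def splits_with_label_shared_product_tree
  by (auto simp: left_leaves_def leaves_shared_product_tree)

lemma right_of_product_shared_product_tree:
  "right_of_product shared_product_tree 1 = {[R, L], [R, R]}"
  "right_of_product shared_product_tree 2 = {[L, R], [R, R]}"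
  unfolding right_of_product_def splits_with_label_shared_product_tree
  by (auto simp: right_leaves_def leaves_shared_product_tree)

text \<open>
  Product 1 is a natural number, so the simplifier turns it into \<open>Suc 0\<close> before it can match
  the equations above; hence the unfolding.
\<close>

lemmas shared_product_tree_sets =
  leaves_shared_product_tree tree_products_shared_product_tree
  left_of_product_shared_product_tree[unfolded One_nat_def]
  right_of_product_shared_product_tree[unfolded One_nat_def]

lemma feasible_half_iff:
  "feasible half shared_product_tree y \<longleftrightarrow>
     y [L, L] + y [L, R] + y [R, L] + y [R, R] = 1 \<and>
     y [L, L] + y [L, R] \<le> 1/2 \<and> y [L, L] + y [R, L] \<le> 1/2 \<and>
     y [R, L] + y [R, R] \<le> 1/2 \<and> y [L, R] + y [R, R] \<le> 1/2 \<and>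
     0 \<le> y [L, L] \<and> 0 \<le> y [L, R] \<and> 0 \<le> y [R, L] \<and> 0 \<le> y [R, R]"
  unfolding feasible_def by (auto simp: half_def shared_product_tree_sets)

lemma within_capacities_half_iff:
  "within_capacities half shared_product_tree y \<longleftrightarrow>
     y [L, L] + y [L, R] \<le> 1/2 \<and> y [L, L] + y [R, L] \<le> 1/2 \<and>
     y [R, L] + y [R, R] \<le> 1/2 \<and> y [L, R] + y [R, R] \<le> 1/2 \<and>
     y [L, L] + y [L, R] + y [R, L] + y [R, R] \<le> 1"
  unfolding within_capacities_def by (auto simp: half_def shared_product_tree_sets)

lemma objective_bait_revenue:
  "objective bait_revenue shared_product_tree y = 3 * y [L, L] + 2 * y [L, R] + 2 * y [R, L]"
  by (simp add: objective_def leaves_shared_product_tree label_shared_product_tree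
      bait_revenue_def)

lemma foldl_greedy_step_unvisited:
  "l \<notin> set ls \<Longrightarrow> foldl (greedy_step x t) y ls l = y l"
  by (induction ls arbitrary: y) (auto simp: greedy_step_def)

text \<open>
  In a revenue order, a leaf of strictly larger revenue than all others is visited first, and
  each leaf is visited once, so the first step fixes its value for good.
\<close>

lemma greedy_solution_top_leaf:
  assumes greedy: "greedy_solution \<rho> x t y"
    and top: "l \<in> leaves t"
    and strict: "\<And>l'. l' \<in> leaves t \<Longrightarrow> l' \<noteq> l \<Longrightarrow> \<rho> (label t l') < \<rho> (label t l)"
  shows "y l = (GREATEST q. within_capacities x t ((\<lambda>_. 0)(l := q)))"
proof -
  obtain ls where order: "revenue_order \<rho> t ls"
    and y: "y = foldl (greedy_step x t) (\<lambda>_. 0) ls"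
    using greedy by (auto simp: greedy_solution_def)
  obtain l' ls' where ls: "ls = l' # ls'"
    using order top by (cases ls) (auto simp: revenue_order_def)
  have "l' = l"
    using order top strict[of l'] unfolding ls revenue_order_def by force
  moreover have "l' \<notin> set ls'"
    using order by (simp add: ls revenue_order_def)
  ultimately show ?thesis
    by (simp add: y ls foldl_greedy_step_unvisited) (simp add: greedy_step_def)
qed

lemma greedy_solution_takes_bait:
  assumes "greedy_solution bait_revenue half shared_product_tree y"
  shows "y [L, L] = 1/2"
proof -
  have "y [L, L] =
      (GREATEST q. within_capacities half shared_product_tree ((\<lambda>_. 0)([L, L] := q)))"
    using assms by (rule greedy_solution_top_leaf)
      (auto simp: leaves_shared_product_tree label_shared_product_tree bait_revenue_def)
  also have "\<dots> = 1/2"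
    by (rule Greatest_equality) (auto simp: within_capacities_half_iff)
  finally show ?thesis .
qed

theorem proposition3:
  "\<exists>(n :: nat) (x :: nat \<Rightarrow> real) (t :: pdtree) (\<rho> :: nat \<Rightarrow> real).
     (\<forall>i\<in>{1..n}. 0 \<le> x i \<and> x i \<le> 1) \<and>
     purchase_decision_tree n t \<and>
     \<rho> 0 = 0 \<and>
     (\<forall>y. greedy_solution \<rho> x t y \<longrightarrow> \<not> optimal \<rho> x t y)"
proof (intro exI conjI allI impI)
  show "\<forall>i\<in>{1..2::nat}. 0 \<le> half i \<and> half i \<le> 1"
    by (simp add: half_def)
  show "purchase_decision_tree 2 shared_product_tree"
    by (rule purchase_decision_tree_shared_product_tree)
  show "bait_revenue 0 = 0"
    by (simp add: bait_revenue_def)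
  fix y
  assume "greedy_solution bait_revenue half shared_product_tree y"
  then have bait: "y [L, L] = 1/2"
    by (rule greedy_solution_takes_bait)
  show "\<not> optimal bait_revenue half shared_product_tree y"
  proof
    assume opt: "optimal bait_revenue half shared_product_tree y"
    then have "feasible half shared_product_tree y"
      by (simp add: optimal_def is_arg_max_def)
    then have "objective bait_revenue shared_product_tree y \<le> 3/2"
      using bait by (simp add: feasible_half_iff objective_bait_revenue)
    moreover
    \<comment> \<open>The off-diagonal point: half a unit on each leaf of revenue 2.\<close>
    define z :: "node \<Rightarrow> real" where "z = (\<lambda>_. 0)([L, R] := 1/2, [R, L] := 1/2)"
    have "feasible half shared_product_tree z"
      by (simp add: feasible_half_iff z_def)
    moreover have "objective bait_revenue shared_product_tree z = 2"
      by (simp add: objective_bait_revenue z_def)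
    ultimately show False
      using opt unfolding optimal_def is_arg_max_def by force
  qed
qed

end
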